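(* Let $f:\mathbb{R}^d\to\mathbb{R}$ be convex and $L$-smooth, let $h:\mathbb{R}^d\to\mathbb{R}\cup\{+\infty\}$ be convex, proper and lower semicontinuous, and suppose $F=f+h$ attains its minimum $F^*=F(x^* )$ at some $x^*\in\mathbb{R}^d$. Let $\gamma,\eta>0$ be arbitrary, let $x_1\in\mathrm{dom}(h)$, and let $\{x_k\}_{k\ge1}$ be generated by $$x_{k+1}=\operatorname*{arg\,min}_{x\in\mathbb{R}^d}\Big\{\langle\nabla f(x_k),x\rangle+\frac{S_k}{2\eta}\|x-x_k\|^2+h(x)\Big\},\qquad S_1=\gamma,\quad S_{k+1}^2=S_k^2\Big(1+\frac{\|x_{k+1}-x_k\|^2}{\eta^2}\Big),\quad k\ge1.$$ Suppose there is $D>0$ such that $\|x_{k+1}-x_k\|\le D$ and $\|x_k-x^*\|\le D$ for all $k\ge1$. Let $\bar x_t:=\frac1t\sum_{k=1}^tx_{k+1}$. Then there is a constant $c>0$ depending only on $L,\gamma,\eta,D$ and $F(x_1)-F^*$ such that for every $t\ge1$, $$F(\bar x_t)-F^*\le\frac{c}{t}.$$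
   Context: $\|\cdot\|$ is the Euclidean norm. $f$ is $L$-smooth if it is continuously differentiable with $L$-Lipschitz gradient. $\mathrm{dom}(h):=\{x:h(x)<+\infty\}$. $S_k>0$. *)

theory Defs
  imports "HOL-Analysis.Analysis"
begin

text \<open>The constant in the theorem must not depend on the dimension \<open>d\<close>, so \<open>d\<close> has to be quantified
  inside the statement and cannot be a type. All the spaces \<open>R^d\<close> are therefore realised as coordinate
  subspaces of one inner product space, that of the finitely supported real sequences.\<close>

typedef rseq = "{x :: nat \<Rightarrow> real. finite {i. x i \<noteq> 0}}"
  morphisms coord Abs_rseq
  by (rule exI[of _ "\<lambda>_. 0"]) simp

setup_lifting type_definition_rseq

lemma finite_supp: "finite {i. coord x i \<noteq> 0}"
  using coord[of x] by simp

lemma rseq_eqI: "(\<And>i. coord x i = coord y i) \<Longrightarrow> x = y"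
  by (metis coord_inject ext)

instantiation rseq :: real_vector
begin

lift_definition zero_rseq :: rseq is "\<lambda>_. 0" by simp

lift_definition plus_rseq :: "rseq \<Rightarrow> rseq \<Rightarrow> rseq" is "\<lambda>x y i. x i + y i"
proof -
  fix f g :: "nat \<Rightarrow> real"
  assume "finite {i. f i \<noteq> 0}" "finite {i. g i \<noteq> 0}"
  then show "finite {i. f i + g i \<noteq> 0}"
    by (rule_tac finite_subset[of _ "{i. f i \<noteq> 0} \<union> {i. g i \<noteq> 0}"]) auto
qed

lift_definition minus_rseq :: "rseq \<Rightarrow> rseq \<Rightarrow> rseq" is "\<lambda>x y i. x i - y i"
proof -
  fix f g :: "nat \<Rightarrow> real"
  assume "finite {i. f i \<noteq> 0}" "finite {i. g i \<noteq> 0}"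
  then show "finite {i. f i - g i \<noteq> 0}"
    by (rule_tac finite_subset[of _ "{i. f i \<noteq> 0} \<union> {i. g i \<noteq> 0}"]) auto
qed

lift_definition uminus_rseq :: "rseq \<Rightarrow> rseq" is "\<lambda>x i. - x i" by simp

lift_definition scaleR_rseq :: "real \<Rightarrow> rseq \<Rightarrow> rseq" is "\<lambda>r x i. r * x i"
proof -
  fix r :: real and f :: "nat \<Rightarrow> real"
  assume "finite {i. f i \<noteq> 0}"
  then show "finite {i. r * f i \<noteq> 0}"
    by (rule_tac finite_subset[of _ "{i. f i \<noteq> 0}"]) auto
qed

instance
proof
qed (transfer, simp add: algebra_simps)+

end

declare zero_rseq.rep_eq [simp] plus_rseq.rep_eq [simp] minus_rseq.rep_eq [simp]
  uminus_rseq.rep_eq [simp] scaleR_rseq.rep_eq [simp]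

instantiation rseq :: real_inner
begin

definition inner_rseq :: "rseq \<Rightarrow> rseq \<Rightarrow> real"
  where "inner_rseq x y = (\<Sum>i | coord x i \<noteq> 0 \<and> coord y i \<noteq> 0. coord x i * coord y i)"

definition norm_rseq :: "rseq \<Rightarrow> real"
  where "norm_rseq x = sqrt (inner x x)"

definition sgn_rseq :: "rseq \<Rightarrow> rseq"
  where "sgn_rseq x = x /\<^sub>R norm x"

definition dist_rseq :: "rseq \<Rightarrow> rseq \<Rightarrow> real"
  where "dist_rseq x y = norm (x - y)"

definition uniformity_rseq :: "(rseq \<times> rseq) filter"
  where "uniformity_rseq = (INF e\<in>{0<..}. principal {(x, y). dist x y < e})"

definition open_rseq :: "rseq set \<Rightarrow> bool"
  where "open_rseq U \<longleftrightarrow> (\<forall>x\<in>U. \<forall>\<^sub>F (x', y) in uniformity. x' = x \<longrightarrow> y \<in> U)"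

lemma inner_rseq_eq_sum:
  assumes "finite I" "{i. coord x i \<noteq> 0 \<and> coord y i \<noteq> 0} \<subseteq> I"
  shows "inner x y = (\<Sum>i\<in>I. coord x i * coord y i)"
  unfolding inner_rseq_def using assms by (intro sum.mono_neutral_left) auto

instance
proof
  fix x y z :: rseq and r :: real
  show "inner x y = inner y x"
    unfolding inner_rseq_def by (intro sum.cong) (auto simp: mult.commute)
  let ?I = "{i. coord x i \<noteq> 0} \<union> {i. coord y i \<noteq> 0} \<union> {i. coord z i \<noteq> 0}"
  have fin: "finite ?I" by (simp add: finite_supp)
  have eq: "inner (x + y) z = (\<Sum>i\<in>?I. coord (x + y) i * coord z i)"
    "inner x z = (\<Sum>i\<in>?I. coord x i * coord z i)"
    "inner y z = (\<Sum>i\<in>?I. coord y i * coord z i)"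
    "inner x y = (\<Sum>i\<in>?I. coord x i * coord y i)"
    "inner (r *\<^sub>R x) y = (\<Sum>i\<in>?I. coord (r *\<^sub>R x) i * coord y i)"
    "inner x x = (\<Sum>i\<in>?I. coord x i * coord x i)"
    by (rule inner_rseq_eq_sum[OF fin]; auto)+
  show "inner (x + y) z = inner x z + inner y z"
    unfolding eq by (simp add: sum.distrib algebra_simps)
  show "inner (r *\<^sub>R x) y = r * inner x y"
    unfolding eq by (simp add: sum_distrib_left algebra_simps)
  show "0 \<le> inner x x"
    unfolding eq by (simp add: sum_nonneg)
  show "inner x x = 0 \<longleftrightarrow> x = 0"
  proof
    assume "inner x x = 0"
    then have sum0: "(\<Sum>i\<in>?I. coord x i * coord x i) = 0"
      by (simp only: eq(6))
    have "coord x i = 0" for i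
    proof (rule ccontr)
      assume "coord x i \<noteq> 0"
      then have "i \<in> ?I" by blast
      then have "coord x i * coord x i = 0"
        using sum_nonneg_0[OF fin _ sum0] by (meson zero_le_square)
      with \<open>coord x i \<noteq> 0\<close> show False by simp
    qed
    then show "x = 0"
      by (intro rseq_eqI) (simp only: zero_rseq.rep_eq)
  qed (simp add: inner_rseq_def)
qed (rule norm_rseq_def sgn_rseq_def dist_rseq_def uniformity_rseq_def open_rseq_def)+

end

definition Rd :: "nat \<Rightarrow> rseq set"
  where "Rd d = {x. \<forall>i\<ge>d. coord x i = 0}"

lemma supp_subset: "\<forall>i\<ge>d. v i = 0 \<Longrightarrow> {i. v i \<noteq> (0::real)} \<subseteq> {..<d::nat}"
  by (metis (mono_tags, lifting) lessThan_iff linorder_not_less mem_Collect_eq subsetI)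

lemma inner_Rd:
  assumes "x \<in> Rd d" "y \<in> Rd d"
  shows "inner x y = (\<Sum>i<d. coord x i * coord y i)"
proof (rule inner_rseq_eq_sum)
  show "{i. coord x i \<noteq> 0 \<and> coord y i \<noteq> 0} \<subseteq> {..<d}"
    using supp_subset[of d "coord x"] assms(1) unfolding Rd_def by blast
qed (rule finite_lessThan)

lemma norm_Rd:
  assumes "x \<in> Rd d"
  shows "norm x = sqrt (\<Sum>i<d. (coord x i)\<^sup>2)"
  unfolding norm_rseq_def inner_Rd[OF assms assms] power2_eq_square ..

lemma coord_Rd: "coord ` Rd d = {v. \<forall>i\<ge>d. v i = 0}"
proof
  show "coord ` Rd d \<subseteq> {v. \<forall>i\<ge>d. v i = 0}"
    unfolding Rd_def by (rule image_subsetI) (rule CollectI, erule CollectD)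
  show "{v. \<forall>i\<ge>d. v i = 0} \<subseteq> coord ` Rd d"
  proof
    fix v :: "nat \<Rightarrow> real"
    assume "v \<in> {v. \<forall>i\<ge>d. v i = 0}"
    then have v: "\<forall>i\<ge>d. v i = 0" by (rule CollectD)
    have "v \<in> {x. finite {i. x i \<noteq> 0}}"
      by (rule CollectI) (rule finite_subset[OF supp_subset[OF v] finite_lessThan])
    then have c: "coord (Abs_rseq v) = v"
      by (rule Abs_rseq_inverse)
    have "Abs_rseq v \<in> Rd d"
      unfolding Rd_def mem_Collect_eq c using v .
    then show "v \<in> coord ` Rd d"
      by (rule image_eqI[where f = coord and x = "Abs_rseq v", OF c[symmetric]])
  qed
qed

lemma subspace_Rd: "subspace (Rd d)"
  by (auto simp: subspace_def Rd_def)

text \<open>Functions on \<open>R^d\<close> are functions on the type \<^typ>\<open>rseq\<close> of which only the values on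
  \<^term>\<open>Rd d\<close> matter. Since derivatives are taken within this subspace and \<open>g x\<close> lies in it,
  \<open>g x\<close> is the usual gradient of \<open>f\<close> at \<open>x\<close>.\<close>

definition is_gradient :: "nat \<Rightarrow> (rseq \<Rightarrow> real) \<Rightarrow> (rseq \<Rightarrow> rseq) \<Rightarrow> bool"
  where "is_gradient d f g \<longleftrightarrow>
    (\<forall>x\<in>Rd d. g x \<in> Rd d \<and> (f has_derivative (\<lambda>v. inner (g x) v)) (at x within Rd d))"

definition smooth_with_gradient :: "nat \<Rightarrow> real \<Rightarrow> (rseq \<Rightarrow> real) \<Rightarrow> (rseq \<Rightarrow> rseq) \<Rightarrow> bool"
  where "smooth_with_gradient d L f g \<longleftrightarrow>
    is_gradient d f g \<and> continuous_on (Rd d) g \<and> L-lipschitz_on (Rd d) g"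

definition edom :: "nat \<Rightarrow> (rseq \<Rightarrow> ereal) \<Rightarrow> rseq set"
  where "edom d h = {x \<in> Rd d. h x < \<infinity>}"

definition proper_fun :: "nat \<Rightarrow> (rseq \<Rightarrow> ereal) \<Rightarrow> bool"
  where "proper_fun d h \<longleftrightarrow> (\<forall>x\<in>Rd d. h x \<noteq> -\<infinity>) \<and> edom d h \<noteq> {}"

definition ereal_convex :: "nat \<Rightarrow> (rseq \<Rightarrow> ereal) \<Rightarrow> bool"
  where "ereal_convex d h \<longleftrightarrow>
    (\<forall>x\<in>Rd d. \<forall>y\<in>Rd d. \<forall>u. 0 < u \<and> u < 1 \<longrightarrow>
      h (u *\<^sub>R x + (1 - u) *\<^sub>R y) \<le> ereal u * h x + ereal (1 - u) * h y)"

definition lsc_fun :: "nat \<Rightarrow> (rseq \<Rightarrow> ereal) \<Rightarrow> bool"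
  where "lsc_fun d h \<longleftrightarrow> (\<forall>x\<in>Rd d. h x \<le> Liminf (at x within Rd d) h)"

definition objective :: "(rseq \<Rightarrow> real) \<Rightarrow> (rseq \<Rightarrow> ereal) \<Rightarrow> rseq \<Rightarrow> ereal"
  where "objective f h x = ereal (f x) + h x"

definition prox_model ::
    "(rseq \<Rightarrow> rseq) \<Rightarrow> (rseq \<Rightarrow> ereal) \<Rightarrow> real \<Rightarrow> real \<Rightarrow> rseq \<Rightarrow> rseq \<Rightarrow> ereal"
  where "prox_model g h \<eta> s z y =
    ereal (inner (g z) y + s / (2 * \<eta>) * (norm (y - z))\<^sup>2) + h y"

text \<open>The sequences are indexed from 1; their values at 0 are irrelevant.\<close>

definition generated_by ::
    "nat \<Rightarrow> (rseq \<Rightarrow> rseq) \<Rightarrow> (rseq \<Rightarrow> ereal) \<Rightarrow> real \<Rightarrow> real \<Rightarrow> (nat \<Rightarrow> rseq) \<Rightarrow> (nat \<Rightarrow> real) \<Rightarrow> bool"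
  where "generated_by d g h \<gamma> \<eta> x S \<longleftrightarrow>
    S 1 = \<gamma> \<and>
    (\<forall>k\<ge>1. S k > 0 \<and>
      is_arg_min (prox_model g h \<eta> (S k) (x k)) (\<lambda>y. y \<in> Rd d) (x (k + 1)) \<and>
      (S (k + 1))\<^sup>2 = (S k)\<^sup>2 * (1 + (norm (x (k + 1) - x k))\<^sup>2 / \<eta>\<^sup>2))"

definition average_iterate :: "(nat \<Rightarrow> rseq) \<Rightarrow> nat \<Rightarrow> rseq"
  where "average_iterate x t = (1 / real t) *\<^sub>R (\<Sum>k=1..t. x (k + 1))"

end

theory Submission
  imports Defs
begin

text \<open>With \<open>e\<^sub>k = F(x\<^sub>k) - F\<^sup>*\<close> and \<open>r\<^sub>k = \<parallel>x\<^sub>k\<^sub>+\<^sub>1 - x\<^sub>k\<parallel>\<close>, the stepsizes stay bounded: as long as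
  \<open>S\<^sub>k > \<eta> L\<close> the potential \<open>S\<^sub>k + e\<^sub>k / \<eta>\<close> does not increase, since the descent of \<open>F\<close> pays for
  \<open>S\<^sub>k\<^sub>+\<^sub>1 - S\<^sub>k \<le> S\<^sub>k r\<^sub>k\<^sup>2 / (2 \<eta>\<^sup>2)\<close>, and after a step with \<open>S\<^sub>k \<le> \<eta> L\<close> it is bounded outright because
  \<open>r\<^sub>k\<close> and \<open>\<parallel>x\<^sub>k - x\<^sup>*\<parallel>\<close> are at most \<open>D\<close>. Given \<open>S\<^sub>k \<le> M\<close>, the recursion makes \<open>\<Sum> r\<^sub>k\<^sup>2\<close> bounded, and
  summing the proximal inequality at \<open>x\<^sup>*\<close> by parts bounds \<open>\<Sum> e\<^sub>k\<^sub>+\<^sub>1\<close>. Jensen's inequality concludes.\<close>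

section \<open>Smooth convex functions and the proximal step\<close>

text \<open>Let \<open>u\<close> tend to 0 from the right. Below, this removes the second-order
  remainder left after moving a fraction \<open>u\<close> along a segment and dividing by
  \<open>u\<close>.\<close>

lemma le_of_le_add_mult:
  fixes a b p :: real
  assumes "\<And>u. 0 < u \<Longrightarrow> u < 1 \<Longrightarrow> a \<le> b + u * p"
  shows "a \<le> b"
proof (rule tendsto_lowerbound)
  show "((\<lambda>u. b + u * p) \<longlongrightarrow> b) (at_right 0)"
    by (auto intro!: tendsto_eq_intros)
  have "\<forall>\<^sub>F u in at_right 0. u \<in> {0<..<1::real}"
    by (rule eventually_at_right_real) simp
  then show "\<forall>\<^sub>F u in at_right 0. a \<le> b + u * p"
    by eventually_elim (use assms in auto)
qed simp

text \<open>The descent lemma, obtained from the mean value theorem along the segment instead of an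
  integral. The segment stays in the convex set \<open>W\<close>, so derivatives within
  \<open>W\<close> suffice.\<close>

lemma lipschitz_gradient_upper_bound:
  fixes f :: "'a::real_inner \<Rightarrow> real"
  assumes "convex W" "x \<in> W" "y \<in> W"
    and der: "\<And>z. z \<in> W \<Longrightarrow> (f has_derivative (\<lambda>v. inner (g z) v)) (at z within W)"
    and lip: "L-lipschitz_on W g"
  shows "f y \<le> f x + inner (g x) (y - x) + L / 2 * (norm (y - x))\<^sup>2"
proof -
  define w where "w = y - x"
  define p where "p t = x + t *\<^sub>R w" for t
  have pW: "p t \<in> W" if "0 \<le> t" "t \<le> 1" for t
    using convexD_alt[OF \<open>convex W\<close> \<open>x \<in> W\<close> \<open>y \<in> W\<close> that]
    by (simp add: p_def w_def algebra_simps)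
  \<comment> \<open>\<open>q\<close> is \<open>f\<close> along the segment minus its linear and
    quadratic model terms, so the claim is \<open>q 1 \<le> q 0\<close>. The Lipschitz bound makes
    the derivative of \<open>q\<close> nonpositive at the intermediate point.\<close>
  define q where "q t = f (p t) - t * inner (g x) w - L / 2 * t\<^sup>2 * (norm w)\<^sup>2" for t
  have "\<exists>t\<in>{0..1}. q 1 - q 0
    = (\<lambda>s. inner (g (p t)) (s *\<^sub>R w) - s * inner (g x) w - L * t * s * (norm w)\<^sup>2) (1 - 0)"
  proof (rule mvt_very_simple)
    fix t :: real assume t: "0 \<le> t" "t \<le> 1"
    have "(p has_derivative (\<lambda>s. s *\<^sub>R w)) (at t within {0..1})"
      unfolding p_def by (auto intro!: derivative_eq_intros)
    from has_derivative_in_compose2[OF der _ _ this] pW t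
    have "((\<lambda>t. f (p t)) has_derivative (\<lambda>s. inner (g (p t)) (s *\<^sub>R w))) (at t within {0..1})"
      by fastforce
    then show "(q has_derivative
        (\<lambda>s. inner (g (p t)) (s *\<^sub>R w) - s * inner (g x) w - L * t * s * (norm w)\<^sup>2)) (at t within {0..1})"
      unfolding q_def by (auto intro!: derivative_eq_intros simp: fun_eq_iff)
  qed simp
  then obtain t where t: "0 \<le> t" "t \<le> 1"
    and eq: "q 1 - q 0 = inner (g (p t) - g x) w - L * t * (norm w)\<^sup>2"
    by (auto simp: inner_diff_left)
  have "inner (g (p t) - g x) w \<le> norm (g (p t) - g x) * norm w"
    by (rule norm_cauchy_schwarz)
  also have "\<dots> \<le> (L * norm (p t - x)) * norm w"
    using lipschitz_onD[OF lip pW[OF t] \<open>x \<in> W\<close>] by (simp add: mult_right_mono dist_norm)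
  also have "\<dots> = L * t * (norm w)\<^sup>2"
    using t by (simp add: p_def power2_eq_square)
  finally have "q 1 \<le> q 0"
    using eq by simp
  then show ?thesis
    by (simp add: q_def p_def w_def)
qed

text \<open>The gradient of \<open>- f\<close> is Lipschitz too, so the descent lemma for
  \<open>- f\<close> bounds \<open>f z\<close> below by the tangent up to an error of order
  \<open>u\<^sup>2\<close>. Convexity bounds \<open>f z\<close> above; divide by \<open>u\<close>
  and let it vanish.\<close>

lemma convex_gradient_lower_bound:
  fixes f :: "'a::real_inner \<Rightarrow> real"
  assumes conv: "convex_on W f" and xy: "x \<in> W" "y \<in> W"
    and der: "\<And>z. z \<in> W \<Longrightarrow> (f has_derivative (\<lambda>v. inner (g z) v)) (at z within W)"
    and lip: "L-lipschitz_on W g"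
  shows "f x + inner (g x) (y - x) \<le> f y"
proof (rule le_of_le_add_mult)
  fix u :: real assume u: "0 < u" "u < 1"
  have "convex W"
    using conv by (simp add: convex_on_def)
  define z where "z = (1 - u) *\<^sub>R x + u *\<^sub>R y"
  have zx: "z - x = u *\<^sub>R (y - x)"
    by (simp add: z_def algebra_simps)
  have "z \<in> W"
    unfolding z_def using \<open>convex W\<close> xy u by (intro convexD_alt) auto
  have lip': "L-lipschitz_on W (\<lambda>z. - g z)"
    using lip by (simp add: lipschitz_on_def dist_minus)
  have der': "((\<lambda>z. - f z) has_derivative (\<lambda>v. inner (- g z) v)) (at z within W)" if "z \<in> W" for z
    using has_derivative_minus[OF der[OF that]] by simp
  have "- f z \<le> - f x + inner (- g x) (z - x) + L / 2 * (norm (z - x))\<^sup>2"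
    by (rule lipschitz_gradient_upper_bound[OF \<open>convex W\<close> xy(1) \<open>z \<in> W\<close> der' lip'])
  moreover have "f z \<le> (1 - u) * f x + u * f y"
    unfolding z_def using convex_onD[OF conv] xy u by simp
  moreover have "(norm (z - x))\<^sup>2 = u * (u * (norm (y - x))\<^sup>2)" "inner (- g x) (z - x) = - (u * inner (g x) (y - x))"
    unfolding zx by (simp_all add: power_mult_distrib power2_eq_square)
  ultimately have "u * (f x + inner (g x) (y - x)) \<le> u * (f y + u * (L / 2 * (norm (y - x))\<^sup>2))"
    by (simp add: distrib_left left_diff_distrib mult.left_commute)
  then show "f x + inner (g x) (y - x) \<le> f y + u * (L / 2 * (norm (y - x))\<^sup>2)"
    using u by simp
qed

text \<open>The quadratic term gives the model growth \<open>s / 2 * (norm (y - z))\<^sup>2\<close>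
  away from its minimiser \<open>z\<close>.\<close>

lemma prox_three_point:
  fixes H :: "'a::real_inner \<Rightarrow> real"
  assumes conv: "convex_on C H" and zy: "z \<in> C" "y \<in> C"
    and min: "\<And>w. w \<in> C \<Longrightarrow>
      inner v z + s / 2 * (norm (z - x))\<^sup>2 + H z \<le> inner v w + s / 2 * (norm (w - x))\<^sup>2 + H w"
  shows "inner v z + s / 2 * (norm (z - x))\<^sup>2 + H z + s / 2 * (norm (y - z))\<^sup>2
    \<le> inner v y + s / 2 * (norm (y - x))\<^sup>2 + H y"
proof -
  \<comment> \<open>First-order optimality of \<open>z\<close> in the direction
    \<open>y - z\<close>, from comparing \<open>z\<close> with points \<open>w\<close> of the
    segment towards \<open>y\<close>.\<close>
  have "0 \<le> inner v (y - z) + s * inner (z - x) (y - z) + (H y - H z)"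
  proof (rule le_of_le_add_mult)
    fix u :: real assume u: "0 < u" "u < 1"
    have "convex C"
      using conv by (simp add: convex_on_def)
    define w where "w = (1 - u) *\<^sub>R z + u *\<^sub>R y"
    have "w \<in> C"
      unfolding w_def using \<open>convex C\<close> zy u by (intro convexD_alt) auto
    have wz: "w = z + u *\<^sub>R (y - z)"
      by (simp add: w_def algebra_simps)
    have wx: "w - x = (z - x) + u *\<^sub>R (y - z)"
      by (simp add: w_def algebra_simps)
    have sq: "(norm (w - x))\<^sup>2
        = (norm (z - x))\<^sup>2 + 2 * u * inner (z - x) (y - z) + u\<^sup>2 * (norm (y - z))\<^sup>2"
      unfolding wx power2_norm_eq_inner
      by (simp only: inner_add_left inner_add_right inner_scaleR_left inner_scaleR_right
          inner_commute[of "y - z" "z - x"]) (simp add: power2_eq_square algebra_simps)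
    have lin: "inner v w = inner v z + u * inner v (y - z)"
      unfolding wz by (simp add: inner_add_right)
    have "H w \<le> (1 - u) * H z + u * H y"
      unfolding w_def using convex_onD[OF conv] zy u by simp
    with min[OF \<open>w \<in> C\<close>]
    have "u * 0 \<le> u * (inner v (y - z) + s * inner (z - x) (y - z) + (H y - H z)
        + u * (s / 2 * (norm (y - z))\<^sup>2))"
      unfolding sq lin by (simp add: power2_eq_square algebra_simps)
    then show "0 \<le> inner v (y - z) + s * inner (z - x) (y - z) + (H y - H z)
        + u * (s / 2 * (norm (y - z))\<^sup>2)"
      using u by (simp add: zero_le_mult_iff)
  qed
  \<comment> \<open>Expanding the square around \<open>z\<close> trades the inner product in the
    optimality condition for squared distances.\<close>
  moreover have "(norm (y - x))\<^sup>2
      = (norm (z - x))\<^sup>2 + 2 * inner (z - x) (y - z) + (norm (y - z))\<^sup>2"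
    unfolding power2_norm_eq_inner by (simp add: inner_diff_left inner_diff_right inner_commute)
  then have "s * inner (z - x) (y - z)
      = s / 2 * (norm (y - x))\<^sup>2 - s / 2 * (norm (z - x))\<^sup>2 - s / 2 * (norm (y - z))\<^sup>2"
    by (simp add: left_diff_distrib distrib_left del: inner_diff_left inner_diff_right)
  ultimately show ?thesis
    unfolding inner_diff_right[of v] by linarith
qed

text \<open>The descent lemma at \<open>z\<close>, the tangent inequality at \<open>y\<close> and
  the three-point inequality add up, and the terms linear in \<open>g x\<close> cancel. It is used
  with \<open>y\<close> the current iterate (descent) and with \<open>y\<close> the minimiser
  (gap).\<close>

lemma proximal_gradient_inequality:
  fixes f H :: "'a::real_inner \<Rightarrow> real"
  assumes f: "convex_on W f" "L-lipschitz_on W g"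
    "\<And>z. z \<in> W \<Longrightarrow> (f has_derivative (\<lambda>v. inner (g z) v)) (at z within W)"
    and H: "convex_on C H" and "C \<subseteq> W" "x \<in> W" "z \<in> C" "y \<in> C"
    and min: "\<And>w. w \<in> C \<Longrightarrow>
      inner (g x) z + s / 2 * (norm (z - x))\<^sup>2 + H z \<le> inner (g x) w + s / 2 * (norm (w - x))\<^sup>2 + H w"
  shows "(f z + H z) - (f y + H y)
    \<le> s / 2 * ((norm (y - x))\<^sup>2 - (norm (y - z))\<^sup>2) + (L / 2 - s / 2) * (norm (z - x))\<^sup>2"
proof -
  have W: "convex W" "z \<in> W" "y \<in> W"
    using assms by (auto simp: convex_on_def)
  have "f z \<le> f x + inner (g x) (z - x) + L / 2 * (norm (z - x))\<^sup>2"
    by (rule lipschitz_gradient_upper_bound[OF W(1) \<open>x \<in> W\<close> W(2) f(3) f(2)])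
  moreover have "f x + inner (g x) (y - x) \<le> f y"
    by (rule convex_gradient_lower_bound[OF f(1) \<open>x \<in> W\<close> W(3) f(3) f(2)])
  moreover note prox_three_point[OF H \<open>z \<in> C\<close> \<open>y \<in> C\<close> min]
  ultimately show ?thesis
    by (simp add: inner_diff_right algebra_simps)
qed

section \<open>The scalar recursion: bounded stepsizes and summable gaps\<close>

text \<open>All that the rate needs from the method, in scalars: \<open>r\<close> is the step
  length, \<open>a\<close> the distance to the minimiser, \<open>e\<close> the objective
  gap.\<close>

locale adaptive_recursion =
  fixes L \<gamma> \<eta> D :: real and S r a e :: "nat \<Rightarrow> real"
  assumes pos: "0 < \<gamma>" "0 < \<eta>" "0 \<le> L"
    and S1: "S 1 = \<gamma>"
    and S_pos: "\<And>k. k \<ge> 1 \<Longrightarrow> 0 < S k"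
    and S_rec: "\<And>k. k \<ge> 1 \<Longrightarrow> (S (k + 1))\<^sup>2 = (S k)\<^sup>2 * (1 + (r k)\<^sup>2 / \<eta>\<^sup>2)"
    and r: "\<And>k. k \<ge> 1 \<Longrightarrow> 0 \<le> r k \<and> r k \<le> D"
    and a: "\<And>k. k \<ge> 1 \<Longrightarrow> 0 \<le> a k \<and> a k \<le> D"
    and e_nonneg: "\<And>k. k \<ge> 1 \<Longrightarrow> 0 \<le> e k"
    and descent: "\<And>k. k \<ge> 1 \<Longrightarrow> e (k + 1) - e k \<le> (L / 2 - S k / \<eta>) * (r k)\<^sup>2"
    and gap: "\<And>k. k \<ge> 1 \<Longrightarrow> e (k + 1)
      \<le> S k / (2 * \<eta>) * ((a k)\<^sup>2 - (a (k + 1))\<^sup>2) + (L / 2 - S k / (2 * \<eta>)) * (r k)\<^sup>2"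
begin

text \<open>The first entry is the initial potential, the second the bound on the potential after a
  step with \<open>S k \<le> \<eta> * L\<close>.\<close>

definition M :: real
  where "M = max (\<gamma> + e 1 / \<eta>) (\<eta> * L + 3 * L * D\<^sup>2 / (2 * \<eta>))"

text \<open>This is \<open>sqrt (1 + q) \<le> 1 + q / 2\<close>, checked on squares.\<close>

lemma S_Suc_le:
  assumes "k \<ge> 1"
  shows "S (k + 1) \<le> S k * (1 + (r k)\<^sup>2 / (2 * \<eta>\<^sup>2))"
proof (rule power2_le_imp_le)
  have "1 + (r k)\<^sup>2 / \<eta>\<^sup>2 \<le> (1 + (r k)\<^sup>2 / (2 * \<eta>\<^sup>2))\<^sup>2"
    by (simp add: power2_sum)
  then show "(S (k + 1))\<^sup>2 \<le> (S k * (1 + (r k)\<^sup>2 / (2 * \<eta>\<^sup>2)))\<^sup>2"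
    unfolding S_rec[OF assms] power_mult_distrib by (intro mult_left_mono) auto
  show "0 \<le> S k * (1 + (r k)\<^sup>2 / (2 * \<eta>\<^sup>2))"
    using S_pos[OF assms] by simp
qed

lemma S_mono_Suc:
  assumes "k \<ge> 1"
  shows "S k \<le> S (k + 1)"
proof (rule power2_le_imp_le)
  show "(S k)\<^sup>2 \<le> (S (k + 1))\<^sup>2"
    unfolding S_rec[OF assms] by (simp add: distrib_left)
  show "0 \<le> S (k + 1)"
    using S_pos[of "k + 1"] by simp
qed

lemma S_ge:
  assumes "k \<ge> 1"
  shows "\<gamma> \<le> S k"
  using assms
proof (induction k rule: dec_induct)
  case (step k)
  with S_mono_Suc[of k] show ?case by simp
qed (use S1 in simp)

text \<open>The summands are bounded separately: growth of \<open>S\<close> costs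
  \<open>L * D\<^sup>2 / (2 * \<eta>)\<close>, and \<open>gap\<close> with its nonpositive terms
  dropped gives \<open>e (k + 1) \<le> L * D\<^sup>2\<close>. Together they produce the factor
  3/2.\<close>

lemma potential_step_small:
  assumes k: "k \<ge> 1" and small: "S k \<le> \<eta> * L"
  shows "S (k + 1) + e (k + 1) / \<eta> \<le> \<eta> * L + 3 * L * D\<^sup>2 / (2 * \<eta>)"
proof -
  have Sp: "0 < S k" using S_pos k .
  have rD: "(r k)\<^sup>2 \<le> D\<^sup>2" and aD: "(a k)\<^sup>2 \<le> D\<^sup>2"
    using r[OF k] a[OF k] by (auto intro: power_mono)
  have SL: "S k / (2 * \<eta>) \<le> L / 2"
    using small pos by (simp add: field_simps)
  have "S (k + 1) \<le> S k * (1 + (r k)\<^sup>2 / (2 * \<eta>\<^sup>2))"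
    by (rule S_Suc_le[OF k])
  also have "\<dots> \<le> (\<eta> * L) * (1 + D\<^sup>2 / (2 * \<eta>\<^sup>2))"
  proof (rule mult_mono)
    show "1 + (r k)\<^sup>2 / (2 * \<eta>\<^sup>2) \<le> 1 + D\<^sup>2 / (2 * \<eta>\<^sup>2)"
      using rD by (simp add: divide_right_mono)
  qed (use small pos in auto)
  also have "\<dots> = \<eta> * L + L * D\<^sup>2 / (2 * \<eta>)"
    using pos by (simp add: field_simps power2_eq_square)
  finally have 1: "S (k + 1) \<le> \<eta> * L + L * D\<^sup>2 / (2 * \<eta>)" .
  have "S k / (2 * \<eta>) * ((a k)\<^sup>2 - (a (k + 1))\<^sup>2) \<le> S k / (2 * \<eta>) * (a k)\<^sup>2"
    using Sp pos by (intro mult_left_mono) auto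
  also have "\<dots> \<le> L / 2 * D\<^sup>2"
    using SL aD pos by (intro mult_mono) auto
  finally have 2: "S k / (2 * \<eta>) * ((a k)\<^sup>2 - (a (k + 1))\<^sup>2) \<le> L / 2 * D\<^sup>2" .
  have "(L / 2 - S k / (2 * \<eta>)) * (r k)\<^sup>2 \<le> L / 2 * (r k)\<^sup>2"
    using Sp pos by (intro mult_right_mono) auto
  also have "\<dots> \<le> L / 2 * D\<^sup>2"
    using rD pos by (intro mult_left_mono) auto
  finally have "e (k + 1) \<le> L * D\<^sup>2"
    using gap[OF k] 2 by linarith
  then have "e (k + 1) / \<eta> \<le> L * D\<^sup>2 / \<eta>"
    using pos by (simp add: divide_right_mono)
  with 1 have "S (k + 1) + e (k + 1) / \<eta> \<le> \<eta> * L + L * D\<^sup>2 / (2 * \<eta>) + L * D\<^sup>2 / \<eta>"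
    by linarith
  also have "\<dots> = \<eta> * L + 3 * L * D\<^sup>2 / (2 * \<eta>)"
    using pos by (simp add: field_simps)
  finally show ?thesis .
qed

text \<open>For such \<open>S k\<close> the gap drops by at least
  \<open>S k * (r k)\<^sup>2 / (2 * \<eta>)\<close>. The weight \<open>1 / \<eta>\<close> turns this
  into exactly the growth allowed by \<open>S_Suc_le\<close>.\<close>

lemma potential_step_large:
  assumes k: "k \<ge> 1" and large: "\<eta> * L \<le> S k"
  shows "S (k + 1) + e (k + 1) / \<eta> \<le> S k + e k / \<eta>"
proof -
  have "L / 2 - S k / \<eta> \<le> - (S k / (2 * \<eta>))"
    using large pos by (simp add: field_simps)
  then have "e (k + 1) - e k \<le> - (S k / (2 * \<eta>)) * (r k)\<^sup>2"
    by (intro order_trans[OF descent[OF k]] mult_right_mono) auto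
  then have "(e (k + 1) - e k) / \<eta> \<le> (- (S k / (2 * \<eta>)) * (r k)\<^sup>2) / \<eta>"
    using pos by (intro divide_right_mono) auto
  also have "\<dots> = - (S k * ((r k)\<^sup>2 / (2 * \<eta>\<^sup>2)))"
    by (simp add: power2_eq_square)
  finally show ?thesis
    using S_Suc_le[OF k] by (simp add: diff_divide_distrib distrib_left)
qed

text \<open>A large step passes the bound on, while a small step restores it whatever came
  before.\<close>

lemma potential_le:
  assumes "k \<ge> 1"
  shows "S k + e k / \<eta> \<le> M"
  using assms
proof (induction k rule: dec_induct)
  case base
  show ?case unfolding M_def S1 by (rule max.cobounded1)
next
  case (step k)
  show ?case
  proof (cases "S k \<le> \<eta> * L")
    case True
    with potential_step_small[of k] step show ?thesis by (simp add: M_def)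
  next
    case False
    with potential_step_large[of k] step show ?thesis by simp
  qed
qed

lemma S_le:
  assumes "k \<ge> 1"
  shows "S k \<le> M"
  using potential_le[OF assms] e_nonneg[OF assms] pos by (smt (verit) divide_nonneg_pos)

lemma M_pos: "0 < M"
  using S_le[of 1] S1 pos by simp

text \<open>Every term on the right telescopes. Shifting \<open>S k\<close> to
  \<open>S (k + 1)\<close> in front of \<open>(a (k + 1))\<^sup>2\<close> costs at most
  \<open>D\<^sup>2\<close> times the increment of \<open>S\<close>; the recursion expresses
  \<open>(S k)\<^sup>2 * (r k)\<^sup>2\<close> as a difference of squares, and
  \<open>\<gamma> \<le> S k\<close> allows division.\<close>

lemma gap_telescoping:
  assumes k: "k \<ge> 1"
  shows "e (k + 1) \<le> (S k * (a k)\<^sup>2 - S (k + 1) * (a (k + 1))\<^sup>2) / (2 * \<eta>)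
    + D\<^sup>2 / (2 * \<eta>) * (S (k + 1) - S k)
    + L / 2 * (\<eta>\<^sup>2 / \<gamma>\<^sup>2) * ((S (k + 1))\<^sup>2 - (S k)\<^sup>2)"
proof -
  have Sp: "0 < S k" using S_pos k .
  have "(S (k + 1) - S k) * (a (k + 1))\<^sup>2 \<le> (S (k + 1) - S k) * D\<^sup>2"
    using S_mono_Suc[OF k] a[of "k + 1"] by (intro mult_left_mono power_mono) auto
  then have "S k * ((a k)\<^sup>2 - (a (k + 1))\<^sup>2)
      \<le> (S k * (a k)\<^sup>2 - S (k + 1) * (a (k + 1))\<^sup>2) + D\<^sup>2 * (S (k + 1) - S k)"
    by (simp add: algebra_simps)
  then have "S k * ((a k)\<^sup>2 - (a (k + 1))\<^sup>2) / (2 * \<eta>)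
      \<le> ((S k * (a k)\<^sup>2 - S (k + 1) * (a (k + 1))\<^sup>2) + D\<^sup>2 * (S (k + 1) - S k)) / (2 * \<eta>)"
    using pos by (intro divide_right_mono) auto
  then have 1: "S k / (2 * \<eta>) * ((a k)\<^sup>2 - (a (k + 1))\<^sup>2)
      \<le> (S k * (a k)\<^sup>2 - S (k + 1) * (a (k + 1))\<^sup>2) / (2 * \<eta>) + D\<^sup>2 / (2 * \<eta>) * (S (k + 1) - S k)"
    by (simp add: add_divide_distrib)
  have "\<gamma>\<^sup>2 * (r k)\<^sup>2 \<le> (S k)\<^sup>2 * (r k)\<^sup>2"
    using S_ge[OF k] pos by (intro mult_right_mono power_mono) auto
  also have "\<dots> = \<eta>\<^sup>2 * ((S (k + 1))\<^sup>2 - (S k)\<^sup>2)"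
    unfolding S_rec[OF k] using pos by (simp add: field_simps)
  finally have "(r k)\<^sup>2 \<le> \<eta>\<^sup>2 / \<gamma>\<^sup>2 * ((S (k + 1))\<^sup>2 - (S k)\<^sup>2)"
    using pos by (simp add: field_simps)
  then have "L / 2 * (r k)\<^sup>2 \<le> L / 2 * (\<eta>\<^sup>2 / \<gamma>\<^sup>2 * ((S (k + 1))\<^sup>2 - (S k)\<^sup>2))"
    using pos by (intro mult_left_mono) auto
  moreover have "(L / 2 - S k / (2 * \<eta>)) * (r k)\<^sup>2 \<le> L / 2 * (r k)\<^sup>2"
    using Sp pos by (intro mult_right_mono) auto
  ultimately show ?thesis
    using gap[OF k] 1 by (simp only: mult.assoc)
qed

lemma sum_gap_le: "(\<Sum>k=1..t. e (k + 1)) \<le> D\<^sup>2 * M / (2 * \<eta>) + L / 2 * (\<eta>\<^sup>2 / \<gamma>\<^sup>2) * M\<^sup>2"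
proof -
  have "(\<Sum>k=1..t. e (k + 1)) \<le> (\<Sum>k=1..t.
      (S k * (a k)\<^sup>2 - S (k + 1) * (a (k + 1))\<^sup>2) / (2 * \<eta>)
      + D\<^sup>2 / (2 * \<eta>) * (S (k + 1) - S k)
      + L / 2 * (\<eta>\<^sup>2 / \<gamma>\<^sup>2) * ((S (k + 1))\<^sup>2 - (S k)\<^sup>2))"
    by (intro sum_mono gap_telescoping) simp
  also have "\<dots> = (S 1 * (a 1)\<^sup>2 - S (t + 1) * (a (t + 1))\<^sup>2) / (2 * \<eta>)
      + D\<^sup>2 / (2 * \<eta>) * (S (t + 1) - S 1)
      + L / 2 * (\<eta>\<^sup>2 / \<gamma>\<^sup>2) * ((S (t + 1))\<^sup>2 - (S 1)\<^sup>2)"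
    by (induction t) (simp_all add: algebra_simps diff_divide_distrib)
  \<comment> \<open>The final term in \<open>a (t + 1)\<close> and the square of \<open>S 1\<close>
    are dropped by sign. Keeping \<open>- S 1\<close> in the middle term cancels the first term
    afterwards.\<close>
  also have "\<dots> \<le> S 1 * D\<^sup>2 / (2 * \<eta>) + D\<^sup>2 / (2 * \<eta>) * (M - S 1) + L / 2 * (\<eta>\<^sup>2 / \<gamma>\<^sup>2) * M\<^sup>2"
  proof (intro add_mono)
    have "S 1 * (a 1)\<^sup>2 \<le> S 1 * D\<^sup>2"
      using a[of 1] S_pos[of 1] by (intro mult_left_mono power_mono) auto
    moreover have "0 \<le> S (t + 1) * (a (t + 1))\<^sup>2"
      using S_pos[of "t + 1"] by simp
    ultimately show "(S 1 * (a 1)\<^sup>2 - S (t + 1) * (a (t + 1))\<^sup>2) / (2 * \<eta>) \<le> S 1 * D\<^sup>2 / (2 * \<eta>)"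
      using pos by (intro divide_right_mono) auto
    show "D\<^sup>2 / (2 * \<eta>) * (S (t + 1) - S 1) \<le> D\<^sup>2 / (2 * \<eta>) * (M - S 1)"
      using pos S_le[of "t + 1"] by (intro mult_left_mono) auto
    have "(S (t + 1))\<^sup>2 \<le> M\<^sup>2"
      using S_le[of "t + 1"] S_pos[of "t + 1"] by (intro power_mono) auto
    then have "(S (t + 1))\<^sup>2 - (S 1)\<^sup>2 \<le> M\<^sup>2"
      using zero_le_power2[of "S 1"] by linarith
    then show "L / 2 * (\<eta>\<^sup>2 / \<gamma>\<^sup>2) * ((S (t + 1))\<^sup>2 - (S 1)\<^sup>2) \<le> L / 2 * (\<eta>\<^sup>2 / \<gamma>\<^sup>2) * M\<^sup>2"
      using pos by (intro mult_left_mono) auto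
  qed
  also have "\<dots> = D\<^sup>2 * M / (2 * \<eta>) + L / 2 * (\<eta>\<^sup>2 / \<gamma>\<^sup>2) * M\<^sup>2"
    by (simp add: algebra_simps diff_divide_distrib)
  finally show ?thesis .
qed

end

section \<open>Real-valued convexity on the effective domain, and averaging\<close>

text \<open>Properness makes \<open>h\<close> finite on its effective domain, so the real arguments
  above apply to \<open>real_of_ereal (h y)\<close> there.\<close>

lemma convex_on_edom:
  assumes "ereal_convex d h" "proper_fun d h"
  shows "convex_on (edom d h) (\<lambda>y. real_of_ereal (h y))"
proof -
  have fin: "h y = ereal (real_of_ereal (h y))" if "y \<in> edom d h" for y
    using that assms(2) by (cases "h y") (auto simp: edom_def proper_fun_def)
  have *: "(1 - u) *\<^sub>R y + u *\<^sub>R z \<in> Rd d \<and> h ((1 - u) *\<^sub>R y + u *\<^sub>R z)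
      \<le> ereal ((1 - u) * real_of_ereal (h y) + u * real_of_ereal (h z))"
    if "0 < u" "u < 1" "y \<in> edom d h" "z \<in> edom d h" for u y z
  proof
    have yz: "y \<in> Rd d" "z \<in> Rd d"
      using that by (auto simp: edom_def)
    then show "(1 - u) *\<^sub>R y + u *\<^sub>R z \<in> Rd d"
      by (intro subspace_add subspace_scale subspace_Rd)
    \<comment> \<open>\<open>ereal_convex\<close> puts its weight on the first point and
      \<open>convex_on\<close> on the second, hence the instance at \<open>1 - u\<close>.\<close>
    have "h ((1 - u) *\<^sub>R y + (1 - (1 - u)) *\<^sub>R z) \<le> ereal (1 - u) * h y + ereal (1 - (1 - u)) * h z"
      using assms(1) yz that unfolding ereal_convex_def by (smt (verit))
    then show "h ((1 - u) *\<^sub>R y + u *\<^sub>R z)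
        \<le> ereal ((1 - u) * real_of_ereal (h y) + u * real_of_ereal (h z))"
      using fin[OF that(3)] fin[OF that(4)] by (metis diff_diff_eq2 add_diff_cancel_left' plus_ereal.simps(1) times_ereal.simps(1))
  qed
  have mem: "(1 - u) *\<^sub>R y + u *\<^sub>R z \<in> edom d h"
    if "0 < u" "u < 1" "y \<in> edom d h" "z \<in> edom d h" for u y z
    using *[OF that] by (auto simp: edom_def intro: le_less_trans)
  have "convex (edom d h)"
    unfolding convex_alt
  proof (intro ballI allI impI)
    fix y z u assume "y \<in> edom d h" "z \<in> edom d h" "0 \<le> u \<and> u \<le> (1::real)"
    \<comment> \<open>\<open>ereal_convex\<close> speaks only of \<open>0 < u < 1\<close>; at the
      endpoints the combination is \<open>y\<close> or \<open>z\<close>.\<close>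
    then show "(1 - u) *\<^sub>R y + u *\<^sub>R z \<in> edom d h"
      using mem[of u y z] by (cases "u = 0"; cases "u = 1") auto
  qed
  then show ?thesis
  proof (rule convex_onI[rotated])
    fix u y z assume "0 < u" "u < (1::real)" "y \<in> edom d h" "z \<in> edom d h"
    then show "real_of_ereal (h ((1 - u) *\<^sub>R y + u *\<^sub>R z))
        \<le> (1 - u) * real_of_ereal (h y) + u * real_of_ereal (h z)"
      using *[of u y z] fin[OF mem[of u y z]] by (metis ereal_less_eq(3))
  qed
qed

text \<open>Jensen's inequality with equal weights.\<close>

lemma convex_on_average:
  fixes F :: "'a::real_vector \<Rightarrow> real" and t :: nat
  assumes "convex_on C F" "t \<ge> 1" "\<And>k. k \<ge> 1 \<Longrightarrow> y k \<in> C"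
  shows "(1 / real t) *\<^sub>R (\<Sum>k=1..t. y k) \<in> C"
    and "F ((1 / real t) *\<^sub>R (\<Sum>k=1..t. y k)) \<le> (\<Sum>k=1..t. F (y k)) / real t"
proof -
  have 1: "(\<Sum>k=1..t. 1 / real t) = 1"
    using assms(2) by simp
  have "(\<Sum>k=1..t. (1 / real t) *\<^sub>R y k) \<in> C"
    using assms 1 by (intro convex_sum) (auto simp: convex_on_def)
  then show "(1 / real t) *\<^sub>R (\<Sum>k=1..t. y k) \<in> C"
    by (simp add: scaleR_sum_right)
  have "F (\<Sum>k=1..t. (1 / real t) *\<^sub>R y k) \<le> (\<Sum>k=1..t. 1 / real t * F (y k))"
    using assms 1 by (intro convex_on_sum[where C = C]) auto
  then show "F ((1 / real t) *\<^sub>R (\<Sum>k=1..t. y k)) \<le> (\<Sum>k=1..t. F (y k)) / real t"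
    by (simp add: scaleR_sum_right sum_divide_distrib)
qed

section \<open>The rate with an explicit constant, and its uniformity\<close>

text \<open>The iterates and the minimiser lie in the effective domain, where the problem is
  real-valued and feeds the scalar recursion. The two sign facts serve to recognise parameters that
  admit no instance.\<close>

lemma adaptive_proximal_gradient_rate:
  fixes L \<gamma> \<eta> D \<Delta> :: real and t :: nat
  defines B_def: "B \<equiv> max (\<gamma> + \<Delta> / \<eta>) (\<eta> * L + 3 * L * D\<^sup>2 / (2 * \<eta>))"
  assumes pos: "\<gamma> > 0" "\<eta> > 0" and t: "t \<ge> 1"
    and f: "convex_on (Rd d) f" "smooth_with_gradient d L f g"
    and h: "ereal_convex d h" "proper_fun d h"
    and xstar: "is_arg_min (objective f h) (\<lambda>y. y \<in> Rd d) xstar"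
    and x1: "x 1 \<in> edom d h" and gen: "generated_by d g h \<gamma> \<eta> x S"
    and D: "\<And>k. k \<ge> 1 \<Longrightarrow> norm (x (k + 1) - x k) \<le> D \<and> norm (x k - xstar) \<le> D"
    and \<Delta>: "objective f h (x 1) - objective f h xstar = ereal \<Delta>"
  shows "objective f h (average_iterate x t) - objective f h xstar
      \<le> ereal ((D\<^sup>2 * B / (2 * \<eta>) + L / 2 * (\<eta>\<^sup>2 / \<gamma>\<^sup>2) * B\<^sup>2) / real t)"
    and "0 \<le> L" and "0 < B"
proof -
  define C H where "C = edom d h" and "H y = real_of_ereal (h y)" for y
  define F where "F y = f y + H y" for y
  have CR: "C \<subseteq> Rd d"
    by (auto simp: C_def edom_def)
  have h_eq: "h y = ereal (H y)" if "y \<in> C" for y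
    using that h(2) by (cases "h y") (auto simp: C_def H_def edom_def proper_fun_def)
  have h_top: "h y = \<infinity>" if "y \<in> Rd d" "y \<notin> C" for y
    using that by (simp add: C_def edom_def)
  have obj: "objective f h y = ereal (F y)" if "y \<in> C" for y
    using h_eq[OF that] by (simp add: objective_def F_def)
  have convH: "convex_on C H"
    unfolding C_def H_def using h by (rule convex_on_edom)
  then have convF: "convex_on C F"
    unfolding F_def using f(1) CR
    by (intro convex_on_add convex_on_subset[OF f(1)]) (auto simp: convex_on_def)
  have der: "(f has_derivative (\<lambda>v. inner (g z) v)) (at z within Rd d)" if "z \<in> Rd d" for z
    using f(2) that by (simp add: smooth_with_gradient_def is_gradient_def)
  have lip: "L-lipschitz_on (Rd d) g"
    using f(2) by (simp add: smooth_with_gradient_def)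
  show L: "0 \<le> L"
    using lip by (rule lipschitz_on_nonneg)
  have xs: "xstar \<in> Rd d" "\<And>y. y \<in> Rd d \<Longrightarrow> objective f h xstar \<le> objective f h y"
    using xstar by (auto simp: is_arg_min_linorder)
  have xsC: "xstar \<in> C"
  \<comment> \<open>Otherwise the minimal objective would be infinite, yet it is finite at
    \<open>x 1\<close>.\<close>
  proof (rule ccontr)
    assume "xstar \<notin> C"
    then show False
      using xs(2)[of "x 1"] h_top[OF xs(1)] obj[of "x 1"] x1 CR by (auto simp: C_def objective_def)
  qed
  have F_ge: "F xstar \<le> F y" if "y \<in> C" for y
    using xs(2)[of y] obj[OF that] obj[OF xsC] that CR by auto
  have argmin: "x (k + 1) \<in> Rd d"
      "\<And>y. y \<in> Rd d \<Longrightarrow> prox_model g h \<eta> (S k) (x k) (x (k + 1)) \<le> prox_model g h \<eta> (S k) (x k) y"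
    if "k \<ge> 1" for k
    using gen that unfolding generated_by_def is_arg_min_linorder by auto
  have xC_Suc: "x (k + 1) \<in> C" if "k \<ge> 1" for k
  \<comment> \<open>The model is finite at \<open>xstar\<close>, so its minimiser cannot have an
    infinite value.\<close>
  proof (rule ccontr)
    assume "x (k + 1) \<notin> C"
    then show False
      using argmin(2)[OF that, of xstar] xs(1) h_top[OF argmin(1)[OF that]] h_eq[OF xsC]
      by (simp add: prox_model_def)
  qed
  have xC: "x k \<in> C" if "k \<ge> 1" for k
  proof (cases "k = 1")
    case True
    with x1 show ?thesis by (simp add: C_def)
  next
    case False
    with xC_Suc[of "k - 1"] that show ?thesis by simp
  qed
  have prox: "F (x (k + 1)) - F y
      \<le> S k / (2 * \<eta>) * ((norm (y - x k))\<^sup>2 - (norm (y - x (k + 1)))\<^sup>2)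
        + (L / 2 - S k / (2 * \<eta>)) * (norm (x (k + 1) - x k))\<^sup>2"
    if k: "k \<ge> 1" and "y \<in> C" for k y
  proof -
    \<comment> \<open>The minimality of \<open>x (k + 1)\<close> in real form, with proximal weight
      \<open>s = S k / \<eta>\<close>.\<close>
    have "inner (g (x k)) (x (k + 1)) + (S k / \<eta>) / 2 * (norm (x (k + 1) - x k))\<^sup>2 + H (x (k + 1))
        \<le> inner (g (x k)) w + (S k / \<eta>) / 2 * (norm (w - x k))\<^sup>2 + H w" if "w \<in> C" for w
      using argmin(2)[OF k, of w] that CR h_eq[OF that] h_eq[OF xC_Suc[OF k]]
      by (auto simp: prox_model_def mult.commute)
    from proximal_gradient_inequality[OF f(1) lip der convH CR _ xC_Suc[OF k] \<open>y \<in> C\<close> this]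
    show ?thesis
      using xC[OF k] CR by (auto simp: F_def mult.commute)
  qed
  have Delta: "F (x 1) - F xstar = \<Delta>"
    using \<Delta> obj[OF xC[of 1]] obj[OF xsC] by simp
  interpret adaptive_recursion L \<gamma> \<eta> D S "\<lambda>k. norm (x (k + 1) - x k)" "\<lambda>k. norm (x k - xstar)"
    "\<lambda>k. F (x k) - F xstar"
  proof
    fix k :: nat assume k: "k \<ge> 1"
    show "F (x (k + 1)) - F xstar - (F (x k) - F xstar)
        \<le> (L / 2 - S k / \<eta>) * (norm (x (k + 1) - x k))\<^sup>2"
      \<comment> \<open>With \<open>y = x k\<close> the first square vanishes and the second doubles
        the coefficient of \<open>S k\<close>.\<close>
      using prox[OF k xC[OF k]] by (simp add: norm_minus_commute algebra_simps)
    show "F (x (k + 1)) - F xstar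
        \<le> S k / (2 * \<eta>) * ((norm (x k - xstar))\<^sup>2 - (norm (x (k + 1) - xstar))\<^sup>2)
          + (L / 2 - S k / (2 * \<eta>)) * (norm (x (k + 1) - x k))\<^sup>2"
      using prox[OF k xsC] by (simp add: norm_minus_commute)
  qed (use pos L gen D F_ge xC in \<open>auto simp: generated_by_def\<close>)
  \<comment> \<open>The locale's bound depends on the run only through \<open>e 1\<close>, which is
    \<open>\<Delta>\<close>.\<close>
  have B_eq: "B = adaptive_recursion.M L \<gamma> \<eta> D (\<lambda>k. F (x k) - F xstar)"
    unfolding B_def M_def Delta ..
  show "0 < B" using M_pos B_eq by simp
  note avg = convex_on_average[OF convF t xC_Suc]
  have "F (average_iterate x t) - F xstar \<le> (\<Sum>k=1..t. F (x (k + 1))) / real t - F xstar"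
    using avg(2) by (simp add: average_iterate_def)
  also have "\<dots> = (\<Sum>k=1..t. F (x (k + 1)) - F xstar) / real t"
    using t by (simp add: sum_subtractf diff_divide_distrib)
  also have "\<dots> \<le> (D\<^sup>2 * B / (2 * \<eta>) + L / 2 * (\<eta>\<^sup>2 / \<gamma>\<^sup>2) * B\<^sup>2) / real t"
    unfolding B_eq by (intro divide_right_mono sum_gap_le) simp
  finally show "objective f h (average_iterate x t) - objective f h xstar
      \<le> ereal ((D\<^sup>2 * B / (2 * \<eta>) + L / 2 * (\<eta>\<^sup>2 / \<gamma>\<^sup>2) * B\<^sup>2) / real t)"
    using obj[OF xsC] obj[of "average_iterate x t"] avg(1) by (simp add: average_iterate_def)
qed

theorem corollary2:
  fixes L \<gamma> \<eta> D \<Delta> :: real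
  assumes "\<gamma> > 0" and "\<eta> > 0" and "D > 0"
  shows "\<exists>c>0. \<forall>(d::nat) (f::rseq \<Rightarrow> real) (g::rseq \<Rightarrow> rseq) (h::rseq \<Rightarrow> ereal)
      (xstar::rseq) (x::nat \<Rightarrow> rseq) (S::nat \<Rightarrow> real).
    convex_on (Rd d) f \<and> smooth_with_gradient d L f g \<and>
    ereal_convex d h \<and> proper_fun d h \<and> lsc_fun d h \<and>
    is_arg_min (objective f h) (\<lambda>y. y \<in> Rd d) xstar \<and>
    x 1 \<in> edom d h \<and> generated_by d g h \<gamma> \<eta> x S \<and>
    (\<forall>k\<ge>1. norm (x (k + 1) - x k) \<le> D \<and> norm (x k - xstar) \<le> D) \<and>
    objective f h (x 1) - objective f h xstar = ereal \<Delta>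
    \<longrightarrow> (\<forall>t\<ge>1. objective f h (average_iterate x t) - objective f h xstar \<le> ereal (c / real t))"
proof -
  \<comment> \<open>\<open>M\<close> and \<open>c\<close> involve only the fixed reals, so
    \<open>c\<close> is chosen before the dimension, the functions and the run.\<close>
  define M where "M = max (\<gamma> + \<Delta> / \<eta>) (\<eta> * L + 3 * L * D\<^sup>2 / (2 * \<eta>))"
  define c where "c = D\<^sup>2 * M / (2 * \<eta>) + L / 2 * (\<eta>\<^sup>2 / \<gamma>\<^sup>2) * M\<^sup>2"
  show ?thesis
  \<comment> \<open>If a sign fails, no instance satisfies the hypotheses and \<open>c = 1\<close>
    works vacuously.\<close>
  proof (cases "0 \<le> L \<and> 0 < M")
    case True
    then have "0 < c"
      unfolding c_def using assms by (intro add_pos_nonneg) auto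
    then show ?thesis
      using adaptive_proximal_gradient_rate(1)[OF assms(1,2), where L = L and D = D and \<Delta> = \<Delta>,
          folded M_def, folded c_def]
      by blast
  next
    case False
    \<comment> \<open>\<open>order_refl\<close> sets \<open>t = 1\<close>; the sign facts do not
      mention \<open>t\<close>.\<close>
    note rate = adaptive_proximal_gradient_rate(2,3)[OF assms(1,2) order_refl, where L = L and D = D
        and \<Delta> = \<Delta>, folded M_def]
    show ?thesis
    proof (intro exI[of _ "1::real"] conjI allI impI)
      fix d f g h xstar x S and t :: nat
      assume "convex_on (Rd d) f \<and> smooth_with_gradient d L f g \<and>
        ereal_convex d h \<and> proper_fun d h \<and> lsc_fun d h \<and>
        is_arg_min (objective f h) (\<lambda>y. y \<in> Rd d) xstar \<and>
        x 1 \<in> edom d h \<and> generated_by d g h \<gamma> \<eta> x S \<and>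
        (\<forall>k\<ge>1. norm (x (k + 1) - x k) \<le> D \<and> norm (x k - xstar) \<le> D) \<and>
        objective f h (x 1) - objective f h xstar = ereal \<Delta>"
      then have False
        using rate[of d f g h xstar x S] False by blast
      then show "objective f h (average_iterate x t) - objective f h xstar \<le> ereal (1 / real t)" ..
    qed simp
  qed
qed

end
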